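(* Every second countable regularly preordered space $(E,\mathscr{T},\le)$ is a perfectly normally preordered space.
   Context: A preorder is a reflexive and transitive relation; a topological preordered space $(E,\mathscr{T},\le)$ is a set $E$ with a topology $\mathscr{T}$ and a preorder $\le$. No separation axiom (neither Hausdorff nor $T_0$) is assumed on the topology. For $x\in E$, $i(x)=\{y: x\le y\}$ and $d(x)=\{y: y\le x\}$; for $S\subset E$, $i(S)=\bigcup_{x\in S} i(x)$, $d(S)=\bigcup_{x\in S} d(x)$. A set $S$ is increasing if $i(S)=S$ and decreasing if $d(S)=S$. The space is semiclosed preordered if $i(x)$ and $d(x)$ are closed for every $x\in E$. The space is regularly preordered if it is semiclosed preordered and: (i) whenever $B$ is a closed increasing set and $x\notin B$, there are an open decreasing set $U\ni x$ and an open increasing set $V\supset B$ with $U\cap V=\emptyset$; and (ii) dually, whenever $A$ is a closed decreasing set and $y\notin A$, there are an open increasing set $V\ni y$ and an open decreasing set $U\supset A$ with $U\cap V=\emptyset$. A function $f:E\to\mathbb{R}$ is isotone if $x\le y\Rightarrow f(x)\le f(y)$. The space is perfectly normally preordered if it is semiclosed preordered and for every closed decreasing set $A$ and closed increasing set $B$ with $A\cap B=\emptyset$ there is a continuous isotone function $f:E\to[0,1]$ such that $A=f^{-1}(0)$ and $B=f^{-1}(1)$. *)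

theory Defs
  imports "HOL-Analysis.Analysis"
begin

text \<open>
  A topological preordered space is a pair of a topology \<open>X\<close> (carrier \<open>topspace X\<close>) and a
  relation \<open>r\<close>, where \<open>(x, y) \<in> r\<close> stands for \<open>x \<le> y\<close>. Since \<open>preorder_on\<close> includes
  \<open>r \<subseteq> topspace X \<times> topspace X\<close>, the hulls below stay inside \<open>topspace X\<close>.
\<close>

definition topological_preordered_space :: "'a topology \<Rightarrow> 'a rel \<Rightarrow> bool" where
  "topological_preordered_space X r \<longleftrightarrow> preorder_on (topspace X) r"

definition up_point :: "'a rel \<Rightarrow> 'a \<Rightarrow> 'a set" where
  "up_point r x = {y. (x, y) \<in> r}"

definition down_point :: "'a rel \<Rightarrow> 'a \<Rightarrow> 'a set" where
  "down_point r x = {y. (y, x) \<in> r}"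

definition increasing_set :: "'a rel \<Rightarrow> 'a set \<Rightarrow> bool" where
  "increasing_set r S \<longleftrightarrow> (\<Union>x\<in>S. up_point r x) = S"

definition decreasing_set :: "'a rel \<Rightarrow> 'a set \<Rightarrow> bool" where
  "decreasing_set r S \<longleftrightarrow> (\<Union>x\<in>S. down_point r x) = S"

definition semiclosed_preordered :: "'a topology \<Rightarrow> 'a rel \<Rightarrow> bool" where
  "semiclosed_preordered X r \<longleftrightarrow>
     topological_preordered_space X r \<and>
     (\<forall>x\<in>topspace X. closedin X (up_point r x) \<and> closedin X (down_point r x))"

definition regularly_preordered :: "'a topology \<Rightarrow> 'a rel \<Rightarrow> bool" where
  "regularly_preordered X r \<longleftrightarrow>
     semiclosed_preordered X r \<and>
     (\<forall>B x. closedin X B \<and> increasing_set r B \<and> x \<in> topspace X - B \<longrightarrow>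
        (\<exists>U V. openin X U \<and> decreasing_set r U \<and> x \<in> U \<and>
               openin X V \<and> increasing_set r V \<and> B \<subseteq> V \<and> U \<inter> V = {})) \<and>
     (\<forall>A y. closedin X A \<and> decreasing_set r A \<and> y \<in> topspace X - A \<longrightarrow>
        (\<exists>U V. openin X V \<and> increasing_set r V \<and> y \<in> V \<and>
               openin X U \<and> decreasing_set r U \<and> A \<subseteq> U \<and> U \<inter> V = {}))"

definition isotone_on :: "'a topology \<Rightarrow> 'a rel \<Rightarrow> ('a \<Rightarrow> real) \<Rightarrow> bool" where
  "isotone_on X r f \<longleftrightarrow> monotone_on (topspace X) (\<lambda>x y. (x, y) \<in> r) (\<le>) f"

definition perfectly_normally_preordered :: "'a topology \<Rightarrow> 'a rel \<Rightarrow> bool" where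
  "perfectly_normally_preordered X r \<longleftrightarrow>
     semiclosed_preordered X r \<and>
     (\<forall>A B. closedin X A \<and> decreasing_set r A \<and>
            closedin X B \<and> increasing_set r B \<and> A \<inter> B = {} \<longrightarrow>
        (\<exists>f. continuous_map X (top_of_set {0..1::real}) f \<and> isotone_on X r f \<and>
             A = {x \<in> topspace X. f x = 0} \<and> B = {x \<in> topspace X. f x = 1}))"

end

theory Submission
  imports Defs
begin

text \<open>
  \<^item> \<^emph>\<open>Separation by sequences.\<close> A second countable space is hereditarily Lindeloef. So, if \<open>B\<close> is
    closed increasing, countably many of the pairs given by regularity suffice to cover any set
    that misses \<open>B\<close> (\<open>separating_sequences\<close>).

  \<^item> \<^emph>\<open>Normality.\<close> Two such coverings, one of \<open>A\<close> and one of \<open>B\<close>, are made disjoint by the trick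
    that proves regular Lindeloef spaces normal: a pair of the first covering has a member around
    \<open>B\<close>, a pair of the second one has a member around \<open>A\<close>, and the \<open>n\<close>-th set of each covering is
    intersected with these members of the first \<open>n\<close> pairs of the other one
    (\<open>regular_imp_normally_preordered\<close>). Finite intersections keep the sets open and monotone.
    Normality interpolates a set between a closed decreasing set and an open decreasing set around
    it, and Urysohn's construction then gives isotone functions (\<open>isotone_Urysohn\<close>).

  \<^item> \<^emph>\<open>Exact zero sets.\<close> Covering the whole complement of a closed decreasing set \<open>A\<close> shows that
    \<open>A\<close> is cut out by countably many Urysohn functions. A convergent series of them is an isotone
    function that vanishes exactly on \<open>A\<close> (\<open>isotone_exact_zero_set\<close>).

  \<^item> \<^emph>\<open>Combination.\<close> The hypotheses are self-dual under reversal of the preorder, so there is also an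
    antitone \<open>g \<ge> 0\<close> that vanishes exactly on \<open>B\<close>. With \<open>f\<close> as above, \<open>f / (f + g)\<close> is isotone
    because it increases in \<open>f\<close> and decreases in \<open>g\<close>, is \<open>0\<close> exactly where \<open>f\<close> is \<open>0\<close>, and is \<open>1\<close>
    exactly where \<open>g\<close> is \<open>0\<close>.
\<close>

section \<open>Monotone sets and duality\<close>

lemma increasing_set_converse [simp]: "increasing_set (r\<inverse>) S = decreasing_set r S"
  by (simp add: increasing_set_def decreasing_set_def up_point_def down_point_def)

lemma decreasing_set_converse [simp]: "decreasing_set (r\<inverse>) S = increasing_set r S"
  by (simp add: increasing_set_def decreasing_set_def up_point_def down_point_def)

lemma decreasing_set_iff:
  assumes "preorder_on E r" "S \<subseteq> E"
  shows "decreasing_set r S \<longleftrightarrow> (\<forall>x y. (x, y) \<in> r \<longrightarrow> y \<in> S \<longrightarrow> x \<in> S)"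
  using assms unfolding decreasing_set_def down_point_def preorder_on_def refl_on_def by blast

lemma increasing_set_iff:
  assumes "preorder_on E r" "S \<subseteq> E"
  shows "increasing_set r S \<longleftrightarrow> (\<forall>x y. (x, y) \<in> r \<longrightarrow> x \<in> S \<longrightarrow> y \<in> S)"
  using decreasing_set_iff [of E "r\<inverse>" S] assms by auto

lemma increasing_set_complement:
  assumes "preorder_on E r" "S \<subseteq> E" "decreasing_set r S"
  shows "increasing_set r (E - S)"
  using assms decreasing_set_iff [OF assms(1,2)] increasing_set_iff [OF assms(1), of "E - S"]
  by (auto simp: preorder_on_def)

lemma decreasing_set_complement:
  assumes "preorder_on E r" "S \<subseteq> E" "increasing_set r S"
  shows "decreasing_set r (E - S)"
  using increasing_set_complement [of E "r\<inverse>" S] assms by simp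

lemma decreasing_set_UN: "(\<And>i. i \<in> I \<Longrightarrow> decreasing_set r (F i)) \<Longrightarrow> decreasing_set r (\<Union>i\<in>I. F i)"
  unfolding decreasing_set_def by blast

lemma increasing_set_UN: "(\<And>i. i \<in> I \<Longrightarrow> increasing_set r (F i)) \<Longrightarrow> increasing_set r (\<Union>i\<in>I. F i)"
  unfolding increasing_set_def by blast

lemma decreasing_set_Int_INT:
  assumes "preorder_on E r" "S \<subseteq> E" "decreasing_set r S"
    and "\<And>i. i \<in> I \<Longrightarrow> decreasing_set r (F i)"
  shows "decreasing_set r (S \<inter> (\<Inter>i\<in>I. F i))"
proof -
  have "x \<in> F i" if "(x, y) \<in> r" "y \<in> F i" "i \<in> I" for x y i
    using that assms(4) unfolding decreasing_set_def down_point_def by blast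
  moreover have "x \<in> S" if "(x, y) \<in> r" "y \<in> S" for x y
    using that assms(3) unfolding decreasing_set_def down_point_def by blast
  ultimately show ?thesis
    using assms(2) by (subst decreasing_set_iff [OF assms(1)]) blast+
qed

lemma increasing_set_Int_INT:
  assumes "preorder_on E r" "S \<subseteq> E" "increasing_set r S"
    and "\<And>i. i \<in> I \<Longrightarrow> increasing_set r (F i)"
  shows "increasing_set r (S \<inter> (\<Inter>i\<in>I. F i))"
  using decreasing_set_Int_INT [of E "r\<inverse>" S I F] assms by simp

lemma regularly_preordered_imp_preorder:
  "regularly_preordered X r \<Longrightarrow> preorder_on (topspace X) r"
  by (simp add: regularly_preordered_def semiclosed_preordered_def topological_preordered_space_def)

lemma semiclosed_preordered_converse:
  "semiclosed_preordered X r \<Longrightarrow> semiclosed_preordered X (r\<inverse>)"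
  by (simp add: semiclosed_preordered_def topological_preordered_space_def
      up_point_def down_point_def)

text \<open>The two clauses of regularity are exchanged by reversing the preorder. So the coverings and
  the functions that vanish on a given set are constructed for one direction only.\<close>

lemma regularly_preordered_converse:
  assumes "regularly_preordered X r"
  shows "regularly_preordered X (r\<inverse>)"
  using assms semiclosed_preordered_converse [of X r]
  unfolding regularly_preordered_def increasing_set_converse decreasing_set_converse
  by (metis Int_commute)

section \<open>From regularity to normality\<close>

text \<open>The set \<open>S\<close> is arbitrary, because every subspace of a second countable space is Lindeloef.
  This serves two cases: a closed \<open>S\<close> for normality, and the open complement of \<open>B\<close> for exact zero
  sets.\<close>

lemma separating_sequences:
  assumes sc: "second_countable X" and reg: "regularly_preordered X r"
    and B: "closedin X B" "increasing_set r B" and S: "S \<subseteq> topspace X - B"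
  obtains U V :: "nat \<Rightarrow> 'a set"
  where "\<And>n. openin X (U n)" "\<And>n. decreasing_set r (U n)"
    and "\<And>n. openin X (V n)" "\<And>n. increasing_set r (V n)"
    and "\<And>n. B \<subseteq> V n" "\<And>n. U n \<inter> V n = {}" "S \<subseteq> (\<Union>n. U n)"
proof -
  define sep where "sep U V \<longleftrightarrow> openin X U \<and> decreasing_set r U \<and> openin X V \<and>
    increasing_set r V \<and> B \<subseteq> V \<and> U \<inter> V = {}" for U V
  define \<U> where "\<U> = {U. \<exists>V. sep U V}"
  have "\<forall>x\<in>S. \<exists>U\<in>\<U>. x \<in> U"
  proof
    fix x assume "x \<in> S"
    with S have "x \<in> topspace X - B" by blast
    then obtain U V where "openin X U" "decreasing_set r U" "x \<in> U"
      "openin X V" "increasing_set r V" "B \<subseteq> V" "U \<inter> V = {}"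
      using reg B unfolding regularly_preordered_def by meson
    then show "\<exists>U\<in>\<U>. x \<in> U"
      unfolding \<U>_def sep_def by blast
  qed
  then have cover: "S \<subseteq> \<Union>\<U>" by blast
  have opeU: "openin X U" if "U \<in> \<U>" for U
    using that by (auto simp: \<U>_def sep_def)
  have "S \<subseteq> topspace X" using S by blast
  moreover have "Lindelof_space (subtopology X S)"
    by (intro second_countable_imp_Lindelof_space second_countable_subtopology sc)
  ultimately obtain \<V> where \<V>: "countable \<V>" "\<V> \<subseteq> \<U>" "S \<subseteq> \<Union>\<V>"
    using cover opeU Lindelof_space_subtopology_subset by metis
  have pre: "preorder_on (topspace X) r"
    using reg by (rule regularly_preordered_imp_preorder)
  \<comment> \<open>Adding the trivial pair makes the family nonempty, so that it can be enumerated even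
    when \<open>S\<close> is empty.\<close>
  have "sep {} (topspace X)"
    using increasing_set_complement [OF pre, of "{}"] closedin_subset [OF B(1)]
    by (auto simp: sep_def decreasing_set_def)
  then have sub: "insert {} \<V> \<subseteq> \<U>"
    using \<V>(2) by (auto simp: \<U>_def)
  obtain U :: "nat \<Rightarrow> 'a set" where U: "range U = insert {} \<V>"
    using uncountable_def [of "insert {} \<V>"] \<V>(1) by auto
  have "U n \<in> \<U>" for n
    using sub rangeI [of U n] unfolding U by (rule subsetD)
  then have "\<exists>V. sep (U n) V" for n
    by (simp add: \<U>_def)
  then obtain V where V: "\<And>n. sep (U n) (V n)" by metis
  have "S \<subseteq> (\<Union>n. U n)"
    using \<V>(3) U by auto
  with V show thesis
    unfolding sep_def by (intro that [of U V]) blast+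
qed

definition normally_preordered :: "'a topology \<Rightarrow> 'a rel \<Rightarrow> bool" where
  "normally_preordered X r \<longleftrightarrow>
     (\<forall>A B. closedin X A \<and> decreasing_set r A \<and> closedin X B \<and> increasing_set r B \<and> A \<inter> B = {} \<longrightarrow>
        (\<exists>U V. openin X U \<and> decreasing_set r U \<and> A \<subseteq> U \<and>
               openin X V \<and> increasing_set r V \<and> B \<subseteq> V \<and> U \<inter> V = {}))"

theorem regular_imp_normally_preordered:
  assumes sc: "second_countable X" and reg: "regularly_preordered X r"
  shows "normally_preordered X r"
  unfolding normally_preordered_def
proof (intro allI impI, elim conjE)
  fix A B
  assume A: "closedin X A" "decreasing_set r A" and B: "closedin X B" "increasing_set r B"
    and "A \<inter> B = {}"
  note pre = regularly_preordered_imp_preorder [OF reg]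
  have AB: "A \<subseteq> topspace X - B" "B \<subseteq> topspace X - A"
    using \<open>A \<inter> B = {}\<close> closedin_subset A(1) B(1) by blast+
  obtain U V where U: "\<And>n::nat. openin X (U n)" "\<And>n. decreasing_set r (U n)"
    and V: "\<And>n::nat. openin X (V n)" "\<And>n. increasing_set r (V n)" "\<And>n. B \<subseteq> V n"
    and UV: "\<And>n. U n \<inter> V n = {}" "A \<subseteq> (\<Union>n. U n)"
    using separating_sequences [OF sc reg B AB(1)] by metis
  obtain V' U' where V': "\<And>n::nat. openin X (V' n)" "\<And>n. increasing_set r (V' n)"
    and U': "\<And>n::nat. openin X (U' n)" "\<And>n. decreasing_set r (U' n)" "\<And>n. A \<subseteq> U' n"
    and UV': "\<And>n. V' n \<inter> U' n = {}" "B \<subseteq> (\<Union>n. V' n)"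
    using separating_sequences [OF sc regularly_preordered_converse [OF reg], of A B] A AB(2)
    by (metis decreasing_set_converse increasing_set_converse)
  define P where "P n = U n \<inter> (\<Inter>k\<in>{..n}. U' k)" for n
  define Q where "Q n = V' n \<inter> (\<Inter>k\<in>{..n}. V k)" for n
  have P: "openin X (P n)" "decreasing_set r (P n)" for n
    unfolding P_def using U U'
    by (auto intro!: openin_Int openin_INT2 decreasing_set_Int_INT [OF pre openin_subset])
  have Q: "openin X (Q n)" "increasing_set r (Q n)" for n
    unfolding Q_def using V V'
    by (auto intro!: openin_Int openin_INT2 increasing_set_Int_INT [OF pre openin_subset])
  \<comment> \<open>Whichever index is smaller, the set with the larger index has been cut down to the other
    member of the pair with the smaller one.\<close>
  have disj: "P m \<inter> Q n = {}" for m n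
  proof (cases "m \<le> n")
    case True
    then have "Q n \<subseteq> V m" by (auto simp: Q_def)
    then show ?thesis using UV(1) [of m] by (auto simp: P_def)
  next
    case False
    then have "P m \<subseteq> U' n" by (auto simp: P_def)
    then show ?thesis using UV'(1) [of n] by (auto simp: Q_def)
  qed
  show "\<exists>U V. openin X U \<and> decreasing_set r U \<and> A \<subseteq> U \<and>
          openin X V \<and> increasing_set r V \<and> B \<subseteq> V \<and> U \<inter> V = {}"
  proof (intro exI conjI)
    show "openin X (\<Union>n. P n)" "openin X (\<Union>n. Q n)"
      using P Q by auto
    show "decreasing_set r (\<Union>n. P n)"
      using P by (intro decreasing_set_UN)
    show "increasing_set r (\<Union>n. Q n)"
      using Q by (intro increasing_set_UN)
    show "A \<subseteq> (\<Union>n. P n)"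
      using UV(2) U'(3) by (fastforce simp: P_def)
    show "B \<subseteq> (\<Union>n. Q n)"
      using UV'(2) V(3) by (fastforce simp: Q_def)
    show "(\<Union>n. P n) \<inter> (\<Union>n. Q n) = {}"
      using disj by blast
  qed
qed

section \<open>The isotone Urysohn lemma\<close>

lemma dyadics_dense:
  fixes x y :: real
  assumes "0 \<le> x" "x < y"
  obtains q where "q \<in> dyadics" "x < q" "q < y"
proof -
  obtain n m k where "of_nat m / 2^n \<le> x" "x < of_nat k / 2^n" "\<bar>m / 2^n - k / 2^n\<bar> < y - x"
    by (rule padic_rational_approximation_straddle_pos_le [of "y - x" 2 x]) (use assms in auto)
  then show thesis
    by (intro that [of "of_nat k / 2^n"]) (auto simp: dyadics_def)
qed

text \<open>Normality says that the relation ``some closed decreasing set lies between \<open>P\<close> and \<open>Q\<close>'' on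
  open decreasing sets is interpolative, so it carries a chain \<open>G\<close> indexed by the dyadic rationals
  of \<open>[0,1]\<close>. The function is \<open>f x = inf {q. x \<in> G q}\<close>. It is isotone because each \<open>G q\<close> is
  decreasing, and its continuity follows since both \<open>{f < a}\<close> and \<open>{f > a}\<close> are unions of open
  sets: of members of \<open>G\<close> in the first case, of complements of the intermediate closed sets in the
  second.\<close>

lemma isotone_Urysohn:
  assumes pre: "preorder_on (topspace X) r" and normal: "normally_preordered X r"
    and A: "closedin X A" "decreasing_set r A" and B: "closedin X B" "increasing_set r B"
    and AB: "A \<inter> B = {}"
  obtains f where "continuous_map X (top_of_set {0..1::real}) f" "isotone_on X r f"
    and "\<And>x. x \<in> A \<Longrightarrow> f x = 0" "\<And>x. x \<in> B \<Longrightarrow> f x = 1"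
proof -
  define R where "R P Q \<longleftrightarrow> openin X P \<and> decreasing_set r P \<and> openin X Q \<and> decreasing_set r Q \<and>
    (\<exists>C. closedin X C \<and> decreasing_set r C \<and> P \<subseteq> C \<and> C \<subseteq> Q)" for P Q
  have interpolate: "\<exists>U. openin X U \<and> decreasing_set r U \<and> C \<subseteq> U \<and> R U Q"
    if C: "closedin X C" "decreasing_set r C" and Q: "openin X Q" "decreasing_set r Q"
      and "C \<subseteq> Q" for C Q
  proof -
    have "closedin X (topspace X - Q)" "increasing_set r (topspace X - Q)"
      using Q increasing_set_complement [OF pre openin_subset] by auto
    moreover have "C \<inter> (topspace X - Q) = {}"
      using \<open>C \<subseteq> Q\<close> by blast
    ultimately obtain U V where UV: "openin X U" "decreasing_set r U" "C \<subseteq> U"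
      "openin X V" "increasing_set r V" "topspace X - Q \<subseteq> V" "U \<inter> V = {}"
      using normal C unfolding normally_preordered_def by meson
    have "closedin X (topspace X - V)" "decreasing_set r (topspace X - V)"
      using UV decreasing_set_complement [OF pre openin_subset] by auto
    moreover have "U \<subseteq> topspace X - V" "topspace X - V \<subseteq> Q"
      using UV openin_subset [OF UV(1)] by blast+
    ultimately have "R U Q"
      unfolding R_def using UV Q by blast
    with UV show ?thesis by blast
  qed
  have "openin X (topspace X - B)" "decreasing_set r (topspace X - B)" "A \<subseteq> topspace X - B"
    using A B AB decreasing_set_complement [OF pre closedin_subset] closedin_subset by blast+
  then obtain U where U: "A \<subseteq> U" "R U (topspace X - B)"
    using interpolate A by meson
  have "\<exists>G :: real \<Rightarrow> 'a set. G 0 = U \<and> G 1 = topspace X - B \<and>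
          (\<forall>x \<in> dyadics \<inter> {0..1}. \<forall>y \<in> dyadics \<inter> {0..1}. x < y \<longrightarrow> R (G x) (G y))"
  proof (rule recursion_on_dyadic_fractions)
    show "R U (topspace X - B)" by fact
    show "\<exists>Z. R P Z \<and> R Z Q" if "R P Q" for P Q
    proof -
      obtain C where C: "closedin X C" "decreasing_set r C" "P \<subseteq> C" "C \<subseteq> Q"
        using \<open>R P Q\<close> unfolding R_def by blast
      then obtain Z where Z: "openin X Z" "decreasing_set r Z" "C \<subseteq> Z" "R Z Q"
        using interpolate [of C Q] \<open>R P Q\<close> unfolding R_def by blast
      then have "R P Z"
        unfolding R_def using C \<open>R P Q\<close> [unfolded R_def] by blast
      with Z show ?thesis by blast
    qed
    show "R P Z" if "R P Q" "R Q Z" for P Q Z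
      using that unfolding R_def by (meson subset_trans)
  qed
  then obtain G :: "real \<Rightarrow> 'a set" where G0: "G 0 = U" and G1: "G 1 = topspace X - B"
    and G: "\<And>x y. \<lbrakk>x \<in> dyadics \<inter> {0..1}; y \<in> dyadics \<inter> {0..1}; x < y\<rbrakk> \<Longrightarrow> R (G x) (G y)"
    by blast
  define D :: "real set" where "D = dyadics \<inter> {0..1}"
  have D01: "0 \<in> D" "1 \<in> D"
    by (force simp: D_def dyadics_def)+
  have G_mono: "G p \<subseteq> G q" if "p \<in> D" "q \<in> D" "p \<le> q" for p q
    using G [of p q] that unfolding R_def D_def by (cases "p = q") auto
  have G_open: "openin X (G q) \<and> decreasing_set r (G q)" if "q \<in> D" for q
    using G [of q 1] G [of 0 q] D01 that unfolding R_def D_def by (cases "q = 1") auto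
  \<comment> \<open>Inserting \<open>1\<close> gives the points outside all \<open>G q\<close>, those of \<open>B\<close>, the value \<open>1\<close>.\<close>
  define f where "f x = Inf (insert 1 {q \<in> D. x \<in> G q})" for x
  have bdd: "bdd_below (insert 1 {q \<in> D. x \<in> G q})" for x
    by (rule bdd_belowI [of _ 0]) (auto simp: D_def)
  have f_less: "f x < a \<longleftrightarrow> 1 < a \<or> (\<exists>q\<in>D. q < a \<and> x \<in> G q)" for x a
    unfolding f_def by (subst cInf_less_iff [OF _ bdd]) auto
  have f_ge: "q \<le> f x" if "q \<in> D" "x \<notin> G q" for q x
    using f_less [of x q] G_mono that by (force simp: D_def not_less [symmetric])
  have f0: "0 \<le> f x" for x
    using f_less [of x 0] by (auto simp: D_def not_less [symmetric])
  have f1: "f x \<le> 1" for x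
    unfolding f_def by (rule cInf_lower [OF _ bdd]) simp
  \<comment> \<open>The second index \<open>p\<close> leaves room for a closed set between \<open>G p\<close> and \<open>G q\<close>, whose complement
    is an open neighbourhood of \<open>x\<close> where \<open>f \<ge> p > a\<close>.\<close>
  have f_greater: "a < f x \<longleftrightarrow> a < 0 \<or> (\<exists>p\<in>D. \<exists>q\<in>D. a < p \<and> p < q \<and> x \<notin> G q)" for x a
  proof (cases "a < 0")
    case True
    then show ?thesis using f0 [of x] by simp
  next
    case False
    have "\<exists>p\<in>D. \<exists>q\<in>D. a < p \<and> p < q \<and> x \<notin> G q" if "a < f x"
    proof -
      obtain q where q: "q \<in> dyadics" "a < q" "q < f x"
        by (rule dyadics_dense [of a "f x"]) (use \<open>a < f x\<close> False in auto)
      obtain p where p: "p \<in> dyadics" "a < p" "p < q"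
        by (rule dyadics_dense [of a q]) (use q False in auto)
      with q have "p \<in> D" "q \<in> D"
        using False f1 [of x] by (auto simp: D_def)
      moreover have "x \<notin> G q"
        using f_less [of x "f x"] q \<open>q \<in> D\<close> by auto
      ultimately show ?thesis using p by blast
    qed
    moreover have "a < f x" if "q \<in> D" "a < p" "p < q" "x \<notin> G q" for p q
      using f_ge [of q x] that by linarith
    ultimately show ?thesis using False by blast
  qed
  have "openin X {x \<in> topspace X. f x < a}" for a
  proof (cases "1 < a")
    case True
    then show ?thesis by (simp add: f_less)
  next
    case False
    then have "{x \<in> topspace X. f x < a} = \<Union> (G ` {q \<in> D. q < a})"
      using G_open openin_subset by (fastforce simp: f_less)
    then show ?thesis using G_open by auto
  qed
  moreover have "openin X {x \<in> topspace X. a < f x}" for a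
  proof (subst openin_subopen, intro ballI)
    fix x assume x: "x \<in> {x \<in> topspace X. a < f x}"
    show "\<exists>T. openin X T \<and> x \<in> T \<and> T \<subseteq> {x \<in> topspace X. a < f x}"
    proof (cases "a < 0")
      case True
      then show ?thesis using x f_greater by (intro exI [of _ "topspace X"]) auto
    next
      case False
      then obtain p q where pq: "p \<in> D" "q \<in> D" "a < p" "p < q" "x \<notin> G q"
        using x f_greater by blast
      then obtain C where C: "closedin X C" "G p \<subseteq> C" "C \<subseteq> G q"
        using G unfolding D_def R_def by blast
      have "a < f y" if "y \<notin> C" for y
        using f_ge [of p y] pq C that by force
      then show ?thesis
        using x C pq by (intro exI [of _ "topspace X - C"]) auto
    qed
  qed
  ultimately have "continuous_map X (top_of_set {0..1}) f"
    unfolding continuous_map_upper_lower_semicontinuous_lt_gen using f0 f1 by auto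
  moreover have "isotone_on X r f"
    unfolding isotone_on_def
  proof (rule monotone_onI)
    fix x y assume "x \<in> topspace X" "y \<in> topspace X" and xy: "(x, y) \<in> r"
    have "x \<in> G q" if "q \<in> D" "y \<in> G q" for q
      using that G_open [of q] xy unfolding decreasing_set_def down_point_def by blast
    then show "f x \<le> f y"
      unfolding f_def by (intro cInf_superset_mono bdd) auto
  qed
  moreover have "f x = 0" if "x \<in> A" for x
  proof -
    have "x \<in> G 0" using that U(1) G0 by blast
    then have "f x \<le> 0"
      unfolding f_def by (intro cInf_lower [OF _ bdd]) (use D01 in auto)
    with f0 [of x] show ?thesis by simp
  qed
  moreover have "f x = 1" if "x \<in> B" for x
    using f_ge [OF D01(2), of x] f1 [of x] that G1 by auto
  ultimately show thesis by (rule that)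
qed

section \<open>Exact zero sets\<close>

text \<open>Weierstrass' test on an abstract topological space. Any positive summable weights would do.\<close>

lemma continuous_map_weighted_suminf:
  fixes f :: "nat \<Rightarrow> 'a \<Rightarrow> real"
  assumes cont: "\<And>n. continuous_map X (top_of_set {0..1}) (f n)"
  shows "continuous_map X euclideanreal (\<lambda>x. \<Sum>n. (1/2) ^ n * f n x)"
proof -
  have bound: "norm ((1/2) ^ n * f n x) \<le> (1/2) ^ n" if "x \<in> topspace X" for n x
  proof -
    have "f n x \<in> {0..1}"
      using cont [of n] that by (auto simp: continuous_map_in_subtopology Pi_iff)
    then show ?thesis by (auto simp: abs_mult intro: mult_left_le)
  qed
  have "uniform_limit (topspace X) (\<lambda>N x. \<Sum>n<N. (1/2) ^ n * f n x)
          (\<lambda>x. \<Sum>n. (1/2) ^ n * f n x) sequentially"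
    by (rule Weierstrass_m_test [of _ _ "\<lambda>n. (1/2) ^ n"]) (use bound in auto)
  moreover have "continuous_map X euclideanreal (\<lambda>x. \<Sum>n<N. (1/2) ^ n * f n x)" for N
    using cont by (intro continuous_map_sum continuous_map_real_mult)
      (auto simp: continuous_map_in_subtopology)
  ultimately show ?thesis
    using Met_TC.continuous_map_uniform_limit [of X "\<lambda>N x. \<Sum>n<N. (1/2) ^ n * f n x" sequentially
        "\<lambda>x. \<Sum>n. (1/2) ^ n * f n x"]
    by (simp add: uniform_limit_iff)
qed

lemma isotone_exact_zero_set:
  assumes sc: "second_countable X" and reg: "regularly_preordered X r"
    and A: "closedin X A" "decreasing_set r A"
  obtains f :: "'a \<Rightarrow> real" where "continuous_map X euclideanreal f" "isotone_on X r f"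
    and "\<And>x. x \<in> topspace X \<Longrightarrow> 0 \<le> f x" "A = {x \<in> topspace X. f x = 0}"
proof -
  note pre = regularly_preordered_imp_preorder [OF reg]
  obtain V U where V: "\<And>n::nat. openin X (V n)"
    and U: "\<And>n::nat. openin X (U n)" "\<And>n. decreasing_set r (U n)" "\<And>n. A \<subseteq> U n"
    and VU: "\<And>n. V n \<inter> U n = {}" "topspace X - A \<subseteq> (\<Union>n. V n)"
    using separating_sequences [OF sc regularly_preordered_converse [OF reg], of A "topspace X - A"] A
    by (metis increasing_set_converse decreasing_set_converse order_refl)
  have "\<exists>f. continuous_map X (top_of_set {0..1::real}) f \<and> isotone_on X r f \<and>
          (\<forall>x\<in>A. f x = 0) \<and> (\<forall>x \<in> topspace X - U n. f x = 1)" for n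
  proof -
    have "closedin X (topspace X - U n)" "increasing_set r (topspace X - U n)"
      "A \<inter> (topspace X - U n) = {}"
      using U increasing_set_complement [OF pre openin_subset] by blast+
    then obtain f where "continuous_map X (top_of_set {0..1::real}) f" "isotone_on X r f"
      "\<And>x. x \<in> A \<Longrightarrow> f x = 0" "\<And>x. x \<in> topspace X - U n \<Longrightarrow> f x = 1"
      using isotone_Urysohn [OF pre regular_imp_normally_preordered [OF sc reg] A] by metis
    then show ?thesis by blast
  qed
  then obtain f where cont: "\<And>n. continuous_map X (top_of_set {0..1::real}) (f n)"
    and iso: "\<And>n. isotone_on X r (f n)" and fA: "\<And>n x. x \<in> A \<Longrightarrow> f n x = 0"
    and fU: "\<And>n x. x \<in> topspace X - U n \<Longrightarrow> f n x = 1"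
    by metis
  have f01: "0 \<le> f n x" "f n x \<le> 1" if "x \<in> topspace X" for n x
    using cont [of n] that by (auto simp: continuous_map_in_subtopology Pi_iff)
  define h where "h x = (\<Sum>n. (1/2) ^ n * f n x)" for x
  have summ: "summable (\<lambda>n. (1/2) ^ n * f n x)" if "x \<in> topspace X" for x
  proof (rule summable_comparison_test')
    show "norm ((1/2) ^ n * f n x) \<le> (1/2) ^ n" if "n \<ge> 0" for n
      using f01 [OF \<open>x \<in> topspace X\<close>, of n] by (auto simp: abs_mult intro: mult_left_le)
  qed (auto intro: summable_geometric)
  \<comment> \<open>A point outside \<open>A\<close> lies in some \<open>V n\<close>, hence outside \<open>U n\<close>, where the \<open>n\<close>-th term is
    positive.\<close>
  have pos: "0 < h x" if x: "x \<in> topspace X - A" for x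
  proof -
    obtain n where "x \<in> V n" using VU(2) x by blast
    then have "f n x = 1" using VU(1) [of n] fU [of x n] x by blast
    then show ?thesis
      unfolding h_def using summ f01 x by (intro suminf_pos2 [of _ n]) auto
  qed
  show thesis
  proof
    show "continuous_map X euclideanreal h"
      unfolding h_def using cont by (rule continuous_map_weighted_suminf)
    show "isotone_on X r h"
      unfolding isotone_on_def
    proof (rule monotone_onI)
      fix x y assume *: "x \<in> topspace X" "y \<in> topspace X" "(x, y) \<in> r"
      then have "f n x \<le> f n y" for n
        using iso [of n] unfolding isotone_on_def by (auto dest: monotone_onD)
      then show "h x \<le> h y"
        unfolding h_def using * by (intro suminf_le summ mult_left_mono) auto
    qed
    show "0 \<le> h x" if "x \<in> topspace X" for x
      unfolding h_def using that by (intro suminf_nonneg summ) (auto simp: f01)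
    have "h x = 0" if "x \<in> A" for x
      using fA [OF that] by (simp add: h_def)
    then show "A = {x \<in> topspace X. h x = 0}"
      using pos closedin_subset [OF A(1)] by fastforce
  qed
qed

section \<open>Perfect normality\<close>

theorem theorem5p3:
  fixes X :: "'a topology" and r :: "'a rel"
  assumes "second_countable X"
    and "regularly_preordered X r"
  shows "perfectly_normally_preordered X r"
  unfolding perfectly_normally_preordered_def
proof (intro conjI allI impI, goal_cases)
  case 1
  show ?case using assms(2) by (simp add: regularly_preordered_def)
next
  case (2 A B)
  then have A: "closedin X A" "decreasing_set r A" and B: "closedin X B" "increasing_set r B"
    and AB: "A \<inter> B = {}" by auto
  obtain f :: "'a \<Rightarrow> real" where f: "continuous_map X euclideanreal f" "isotone_on X r f"
    "\<And>x. x \<in> topspace X \<Longrightarrow> 0 \<le> f x" "A = {x \<in> topspace X. f x = 0}"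
    using isotone_exact_zero_set [OF assms A] by metis
  obtain g :: "'a \<Rightarrow> real" where g: "continuous_map X euclideanreal g" "isotone_on X (r\<inverse>) g"
    "\<And>x. x \<in> topspace X \<Longrightarrow> 0 \<le> g x" "B = {x \<in> topspace X. g x = 0}"
    using isotone_exact_zero_set [OF assms(1) regularly_preordered_converse [OF assms(2)], of B] B
    by (metis decreasing_set_converse)
  \<comment> \<open>Disjointness of \<open>A\<close> and \<open>B\<close> is what makes the quotient below well defined.\<close>
  have pos: "0 < f x + g x" if "x \<in> topspace X" for x
    using f(3,4) g(3,4) AB that by (smt (verit) disjoint_iff mem_Collect_eq)
  define h where "h x = f x / (f x + g x)" for x
  have "continuous_map X euclideanreal h"
    unfolding h_def using f(1) g(1) pos
    by (intro continuous_map_real_divide continuous_map_add) (auto simp: order_less_le)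
  moreover have "0 \<le> h x" "h x \<le> 1" if "x \<in> topspace X" for x
    using pos f(3) g(3) that by (auto simp: h_def divide_le_eq_1)
  moreover have "isotone_on X r h"
    unfolding isotone_on_def
  proof (rule monotone_onI)
    fix x y assume x: "x \<in> topspace X" and y: "y \<in> topspace X" and "(x, y) \<in> r"
    then have le: "f x \<le> f y" "g y \<le> g x"
      using f(2) g(2) unfolding isotone_on_def by (auto dest: monotone_onD)
    have "f x * g y \<le> f y * g x"
      using le f(3) g(3) x y by (intro mult_mono) auto
    then show "h x \<le> h y"
      using pos [OF x] pos [OF y] by (simp add: h_def frac_le_eq divide_simps algebra_simps)
  qed
  moreover have "h x = 0 \<longleftrightarrow> f x = 0" "h x = 1 \<longleftrightarrow> g x = 0" if "x \<in> topspace X" for x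
    using pos [OF that] by (auto simp: h_def)
  ultimately show ?case
    using f(4) g(4) by (intro exI [of _ h]) (auto simp: continuous_map_in_subtopology)
qed

end
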